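(* Let $d\ge 1$, let $A$ be a finite alphabet, let $F:A^{\mathbb{Z}^d}\to A^{\mathbb{Z}^d}$ be a surjective cellular automaton, and let $\mu$ be the uniform Bernoulli measure on $A^{\mathbb{Z}^d}$. Let $\xi$ be the set of equicontinuity points of $F$ and suppose that $\mu(\xi)>0$. Suppose that $F$ admits a measurable eigenvalue $e^{2\pi i\alpha}$, $\alpha\in\mathbb{R}$, associated to a measurable eigenfunction $g:A^{\mathbb{Z}^d}\to\mathbb{C}$. If $g(x)\neq0$ for all $x\in\xi$, then $\alpha$ is not irrational.
   Context: A cellular automaton is a map $F:A^{\mathbb{Z}^d}\to A^{\mathbb{Z}^d}$ of the form $F(x)_{m}=f(x_{m+K})$ for all $m\in\mathbb{Z}^d$, with $K\subset\mathbb{Z}^d$ finite and $f:A^{K}\to A$. The metric on $A^{\mathbb{Z}^d}$ is $\mathrm{dist}(x,y)=2^{-\min\{\|i\|:x_i\ne y_i\}}$ for $x\ne y$, with $\|i\|=\max_s|i_s|$, and $\mathrm{dist}(x,x)=0$. A point $x$ is an equicontinuity point of $F$ if for every $\varepsilon>0$ there is $\delta>0$ such that for all $y$ with $\mathrm{dist}(x,y)<\delta$ and all $n\in\mathbb{N}$, $\mathrm{dist}(F^n(x),F^n(y))<\varepsilon$. The uniform Bernoulli measure $\mu$ is the product of the uniform probability measures on $A$; it is $F$-invariant when $F$ is surjective. A complex number $\lambda=e^{2\pi i\alpha}$ is a measurable eigenvalue of $F$ with associated eigenfunction $g$ if $g:A^{\mathbb{Z}^d}\to\mathbb{C}$ is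 measurable, not $\mu$-almost everywhere zero, and $g\circ F=\lambda g$ $\mu$-almost everywhere. *)

theory Defs
  imports "HOL-Probability.Probability"
begin

text \<open>
  The lattice is \<open>int ^ 'd\<close>, so \<open>d = CARD('d) \<ge> 1\<close>; the alphabet is the (nonempty)
  type \<open>'a::finite\<close>.
\<close>

type_synonym ('a, 'd) config = "int ^ 'd \<Rightarrow> 'a"

definition lattice_norm :: "int ^ 'd::finite \<Rightarrow> nat" where
  "lattice_norm i = Max (range (\<lambda>s. nat \<bar>i $ s\<bar>))"

text \<open>
  On \<^typ>\<open>nat\<close>, \<^const>\<open>Inf\<close> of a nonempty set is its minimum; the set below may be infinite, so
  \<^const>\<open>Min\<close> is not applicable.
\<close>

definition config_dist :: "('a, 'd::finite) config \<Rightarrow> ('a, 'd) config \<Rightarrow> real" where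
  "config_dist x y =
     (if x = y then 0 else 1 / 2 ^ Inf {lattice_norm i | i. x i \<noteq> y i})"

text \<open>
  The restriction to \<open>K\<close> makes the local rule \<open>f\<close> see only the pattern
  \<open>x\<^bsub>m+K\<^esub> = (x\<^bsub>m+k\<^esub>)\<^bsub>k\<in>K\<^esub>\<close>, that is, an element of \<open>A\<^bsup>K\<^esup>\<close>.
\<close>

definition cellular_automaton ::
  "(('a::finite, 'd::finite) config \<Rightarrow> ('a, 'd) config) \<Rightarrow> bool" where
  "cellular_automaton F \<longleftrightarrow>
     (\<exists>K f. finite K \<and> (\<forall>x m. F x m = f (restrict (\<lambda>k. x (m + k)) K)))"

definition equicontinuity_point ::
  "(('a, 'd::finite) config \<Rightarrow> ('a, 'd) config) \<Rightarrow> ('a, 'd) config \<Rightarrow> bool" where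
  "equicontinuity_point F x \<longleftrightarrow>
     (\<forall>\<epsilon>>0. \<exists>\<delta>>0. \<forall>y. config_dist x y < \<delta> \<longrightarrow>
        (\<forall>n. config_dist ((F ^^ n) x) ((F ^^ n) y) < \<epsilon>))"

definition uniform_bernoulli :: "('a::finite, 'd::finite) config measure" where
  "uniform_bernoulli = PiM UNIV (\<lambda>_. uniform_count_measure UNIV)"

definition measurable_eigenfunction ::
  "'b measure \<Rightarrow> ('b \<Rightarrow> 'b) \<Rightarrow> complex \<Rightarrow> ('b \<Rightarrow> complex) \<Rightarrow> bool" where
  "measurable_eigenfunction M F c g \<longleftrightarrow>
     g \<in> borel_measurable M \<and>
     \<not> (AE x in M. g x = 0) \<and>
     (AE x in M. g (F x) = c * g x)"

end

theory Submission
  imports Defs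
begin

text \<open>
  Write \<open>\<mu>\<close> for the uniform Bernoulli measure. Three facts combine.

  First, a surjective cellular automaton preserves \<open>\<mu>\<close>
  (\<open>distr_uniform_bernoulli\<close>). An event that depends on finitely many cells cannot lose mass
  under \<open>F\<inverse>\<close>: if it lost a factor, then \<open>k\<^sup>d\<close> translates of it, placed far apart in a
  large box so as to be independent before and after taking preimages, would lose the
  \<open>k\<^sup>d\<close>-th power of that factor. Surjectivity however gives every pattern on a box a preimage
  on a slightly larger box, so the loss is at most \<open>card A\<close> to the number of cells in the
  boundary layer, which is only of order \<open>k\<^bsup>d-1\<^esup>\<close>.

  Second, let \<open>x\<close> be an equicontinuity point and fix a cell. All points of some cylinder around
  \<open>x\<close> have the same history at that cell as \<open>x\<close>. By Poincare recurrence some point of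
  the cylinder returns to it after \<open>p > 0\<close> steps, so the history of \<open>x\<close> at that cell repeats
  itself with period \<open>p\<close>. The period depends on \<open>x\<close>, but outside a subset of \<open>\<xi>\<close> of
  small measure a common period works. By approximation, every measurable event \<open>B\<close> is nearly
  periodic on \<open>\<xi>\<close>: there is \<open>P > 0\<close> such that for all multiples \<open>n\<close> of \<open>P\<close>
  the points \<open>x\<close> and \<open>F\<^sup>n x\<close> agree about membership in \<open>B\<close>, up to a small part of
  \<open>\<xi>\<close> (\<open>nearly_periodic_on_measurable\<close>).

  Third, apply this to the events \<open>Re g \<ge> 0\<close> and \<open>Im g \<ge> 0\<close>. If \<open>\<alpha>\<close> were
  irrational, the eigenvalue \<open>\<lambda>\<close> would satisfy \<open>\<lambda>\<^sup>P \<noteq> 1\<close>, and some multiple \<open>n\<close> of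
  \<open>P\<close> would have \<open>Re (\<lambda>\<^sup>n) < 0\<close>. Multiplication by such a number takes every nonzero
  complex number out of its quadrant, so \<open>g (F\<^sup>n x) = \<lambda>\<^sup>n g x\<close> lies in a different quadrant
  than \<open>g x\<close> for almost every \<open>x \<in> \<xi>\<close>. Then almost all of \<open>\<xi>\<close> disagrees about one of
  the two events, which contradicts near-periodicity because \<open>\<mu> \<xi> > 0\<close>.
\<close>

section \<open>Events determined by finitely many cells\<close>

interpretation bernoulli: prob_space "uniform_bernoulli :: ('a::finite, 'd::finite) config measure"
  unfolding uniform_bernoulli_def
  by (intro prob_space_PiM prob_space_uniform_count_measure) auto

lemma space_uniform_bernoulli [simp]: "space uniform_bernoulli = UNIV"
  by (simp add: uniform_bernoulli_def space_PiM space_uniform_count_measure)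

definition determined_on :: "(int ^ 'd::finite) set \<Rightarrow> ('a, 'd) config set \<Rightarrow> bool" where
  "determined_on D X \<longleftrightarrow> (\<forall>x y. (\<forall>i\<in>D. x i = y i) \<longrightarrow> x \<in> X \<longrightarrow> y \<in> X)"

lemma determined_onD: "determined_on D X \<Longrightarrow> (\<And>i. i \<in> D \<Longrightarrow> x i = y i) \<Longrightarrow> x \<in> X \<longleftrightarrow> y \<in> X"
  unfolding determined_on_def by metis

lemma determined_on_restrict_iff:
  "determined_on D X \<Longrightarrow> restrict x D \<in> X \<longleftrightarrow> x \<in> X"
  by (rule determined_onD) auto

lemma determined_on_compl: "determined_on D X \<Longrightarrow> determined_on D (- X)"
  unfolding determined_on_def by (metis ComplD ComplI)

lemma determined_on_Int:
  "determined_on D X \<Longrightarrow> determined_on E Y \<Longrightarrow> determined_on (D \<union> E) (X \<inter> Y)"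
  unfolding determined_on_def by (metis IntE IntI UnCI)

lemma measure_cylinder:
  fixes p :: "('a::finite, 'd::finite) config"
  assumes "finite D"
  shows "measure uniform_bernoulli {x. \<forall>i\<in>D. x i = p i} = 1 / real CARD('a) ^ card D"
    and "{x. \<forall>i\<in>D. x i = p i} \<in> sets uniform_bernoulli"
proof -
  interpret product_prob_space "\<lambda>_ :: int ^ 'd. uniform_count_measure (UNIV :: 'a set)" UNIV
    by (intro product_prob_spaceI prob_space_uniform_count_measure) auto
  have emb: "{x. \<forall>i\<in>D. x i = p i}
      = prod_emb UNIV (\<lambda>_ :: int ^ 'd. uniform_count_measure (UNIV :: 'a set)) D (\<Pi>\<^sub>E i\<in>D. {p i})"
    by (auto simp: prod_emb_def space_uniform_count_measure PiE_iff)
  show "measure uniform_bernoulli {x. \<forall>i\<in>D. x i = p i} = 1 / real CARD('a) ^ card D"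
    unfolding emb uniform_bernoulli_def using assms
    by (subst measure_PiM_emb)
       (auto simp: sets_uniform_count_measure measure_uniform_count_measure power_one_over)
  show "{x. \<forall>i\<in>D. x i = p i} \<in> sets uniform_bernoulli"
    unfolding emb uniform_bernoulli_def using assms
    by (intro sets_PiM_I) (auto simp: sets_uniform_count_measure)
qed

text \<open>
  Functions in \<open>D \<rightarrow>\<^sub>E UNIV\<close> are themselves configurations, with value \<^const>\<open>undefined\<close> off
  \<open>D\<close>. So the patterns on \<open>D\<close> that make up an event determined on \<open>D\<close> are simply its
  extensional members, and its measure is a matter of counting them.
\<close>

lemma measure_determined_on:
  fixes X :: "('a::finite, 'd::finite) config set"
  assumes "finite D" "determined_on D X"
  shows "measure uniform_bernoulli X = real (card (X \<inter> (D \<rightarrow>\<^sub>E UNIV))) / real CARD('a) ^ card D"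
    and "X \<in> sets uniform_bernoulli"
proof -
  define C where "C = (\<lambda>p. {x :: ('a, 'd) config. \<forall>i\<in>D. x i = p i})"
  define P where "P = X \<inter> (D \<rightarrow>\<^sub>E UNIV)"
  have fin: "finite P"
    using assms(1) unfolding P_def by (intro finite_Int disjI2 finite_PiE) auto
  have X: "X = (\<Union>p\<in>P. C p)"
  proof (intro set_eqI iffI)
    fix x assume "x \<in> X"
    then have "restrict x D \<in> X" using determined_on_restrict_iff[OF assms(2)] by blast
    then show "x \<in> (\<Union>p\<in>P. C p)"
      by (intro UN_I[of "restrict x D"]) (auto simp: C_def P_def)
  next
    fix x assume "x \<in> (\<Union>p\<in>P. C p)"
    then obtain p where "p \<in> X" "\<forall>i\<in>D. p i = x i" by (auto simp: C_def P_def)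
    then show "x \<in> X" using assms(2) unfolding determined_on_def by blast
  qed
  have sets: "C p \<in> sets uniform_bernoulli" for p
    unfolding C_def by (rule measure_cylinder(2)[OF assms(1)])
  have meas: "measure uniform_bernoulli (C p) = 1 / real CARD('a) ^ card D" for p
    unfolding C_def by (rule measure_cylinder(1)[OF assms(1)])
  show "X \<in> sets uniform_bernoulli"
    unfolding X by (intro sets.finite_UN fin sets)
  have disj: "disjoint_family_on C P"
    unfolding disjoint_family_on_def
  proof (intro ballI impI)
    fix p q assume pq: "p \<in> P" "q \<in> P" "p \<noteq> q"
    then obtain i where "i \<in> D" "p i \<noteq> q i" unfolding P_def by (meson IntE PiE_ext)
    then show "C p \<inter> C q = {}" by (force simp: C_def)
  qed
  have "measure uniform_bernoulli X = (\<Sum>p\<in>P. measure uniform_bernoulli (C p))"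
    unfolding X using sets by (intro bernoulli.finite_measure_finite_Union fin disj) auto
  also have "\<dots> = real (card P) / real CARD('a) ^ card D"
    by (simp add: meas)
  finally show "measure uniform_bernoulli X
      = real (card (X \<inter> (D \<rightarrow>\<^sub>E UNIV))) / real CARD('a) ^ card D" unfolding P_def .
qed

text \<open>
  Restricting to the two disjoint cell sets matches the patterns of the intersection with pairs of
  patterns, so the counts multiply.
\<close>

lemma measure_Int_determined_on:
  fixes X Y :: "('a::finite, 'd::finite) config set"
  assumes D: "finite D" "determined_on D X" and E: "finite E" "determined_on E Y"
    and disj: "D \<inter> E = {}"
  shows "measure uniform_bernoulli (X \<inter> Y)
       = measure uniform_bernoulli X * measure uniform_bernoulli Y"
proof -
  let ?merge = "\<lambda>(p, q) i. if i \<in> D then p i else (q i :: 'a)"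
  have "bij_betw (\<lambda>x. (restrict x D, restrict x E)) ((X \<inter> Y) \<inter> (D \<union> E \<rightarrow>\<^sub>E UNIV))
      ((X \<inter> (D \<rightarrow>\<^sub>E UNIV)) \<times> (Y \<inter> (E \<rightarrow>\<^sub>E UNIV)))"
  proof (rule bij_betwI[where g = ?merge])
    show "(\<lambda>x. (restrict x D, restrict x E)) \<in> (X \<inter> Y) \<inter> (D \<union> E \<rightarrow>\<^sub>E UNIV)
        \<rightarrow> (X \<inter> (D \<rightarrow>\<^sub>E UNIV)) \<times> (Y \<inter> (E \<rightarrow>\<^sub>E UNIV))"
      using D E by (auto simp: determined_on_restrict_iff)
    show "?merge \<in> (X \<inter> (D \<rightarrow>\<^sub>E UNIV)) \<times> (Y \<inter> (E \<rightarrow>\<^sub>E UNIV))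
        \<rightarrow> (X \<inter> Y) \<inter> (D \<union> E \<rightarrow>\<^sub>E UNIV)"
    proof
      fix pq assume "pq \<in> (X \<inter> (D \<rightarrow>\<^sub>E UNIV)) \<times> (Y \<inter> (E \<rightarrow>\<^sub>E UNIV))"
      then obtain p q where pq: "pq = (p, q)" "p \<in> X" "p \<in> D \<rightarrow>\<^sub>E UNIV" "q \<in> Y" "q \<in> E \<rightarrow>\<^sub>E UNIV"
        by auto
      have "?merge pq \<in> X \<longleftrightarrow> p \<in> X" using pq by (intro determined_onD[OF D(2)]) auto
      moreover have "?merge pq \<in> Y \<longleftrightarrow> q \<in> Y"
        using pq disj by (intro determined_onD[OF E(2)]) auto
      ultimately show "?merge pq \<in> (X \<inter> Y) \<inter> (D \<union> E \<rightarrow>\<^sub>E UNIV)"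
        using pq by (auto simp: PiE_iff extensional_def)
    qed
  next
    fix x assume "x \<in> (X \<inter> Y) \<inter> (D \<union> E \<rightarrow>\<^sub>E (UNIV :: 'a set))"
    then show "?merge (restrict x D, restrict x E) = x"
      by (auto simp: fun_eq_iff PiE_iff extensional_def)
  next
    fix pq assume "pq \<in> (X \<inter> (D \<rightarrow>\<^sub>E UNIV)) \<times> (Y \<inter> (E \<rightarrow>\<^sub>E (UNIV :: 'a set)))"
    then show "(restrict (?merge pq) D, restrict (?merge pq) E) = pq"
      using disj by (auto simp: fun_eq_iff PiE_iff extensional_def restrict_def)
  qed
  then have "card ((X \<inter> Y) \<inter> (D \<union> E \<rightarrow>\<^sub>E UNIV))
      = card (X \<inter> (D \<rightarrow>\<^sub>E UNIV)) * card (Y \<inter> (E \<rightarrow>\<^sub>E UNIV))"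
    by (simp add: bij_betw_same_card card_cartesian_product)
  then show ?thesis
    using measure_determined_on(1)[OF D] measure_determined_on(1)[OF E]
      measure_determined_on(1)[OF _ determined_on_Int[OF D(2) E(2)]] D(1) E(1) disj
    by (simp add: card_Un_disjoint power_add)
qed

lemma measure_INT_determined_on:
  fixes X :: "'v \<Rightarrow> ('a::finite, 'd::finite) config set"
  assumes "finite V" and "\<And>v. v \<in> V \<Longrightarrow> finite (D v)"
    and "\<And>v. v \<in> V \<Longrightarrow> determined_on (D v) (X v)" and "disjoint_family_on D V"
  shows "measure uniform_bernoulli (\<Inter>v\<in>V. X v) = (\<Prod>v\<in>V. measure uniform_bernoulli (X v))"
    and "determined_on (\<Union>v\<in>V. D v) (\<Inter>v\<in>V. X v)"
proof -
  have "measure uniform_bernoulli (\<Inter>v\<in>V. X v) = (\<Prod>v\<in>V. measure uniform_bernoulli (X v)) \<and>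
      determined_on (\<Union>v\<in>V. D v) (\<Inter>v\<in>V. X v)"
    using assms
  proof (induction V rule: finite_induct)
    case empty
    then show ?case using bernoulli.prob_space by (simp add: determined_on_def)
  next
    case (insert v V)
    have disj: "D v \<inter> (\<Union>w\<in>V. D w) = {}"
      using insert.hyps(2) insert.prems(3) by (auto simp: disjoint_family_on_def)
    have IH: "measure uniform_bernoulli (\<Inter>v\<in>V. X v) = (\<Prod>v\<in>V. measure uniform_bernoulli (X v))"
      "determined_on (\<Union>v\<in>V. D v) (\<Inter>v\<in>V. X v)"
      using insert.IH insert.prems by (auto simp: disjoint_family_on_def)
    have "measure uniform_bernoulli (X v \<inter> (\<Inter>w\<in>V. X w))
        = measure uniform_bernoulli (X v) * measure uniform_bernoulli (\<Inter>w\<in>V. X w)"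
      using insert.hyps insert.prems IH disj by (intro measure_Int_determined_on) auto
    moreover have "determined_on (D v \<union> (\<Union>w\<in>V. D w)) (X v \<inter> (\<Inter>w\<in>V. X w))"
      using insert.prems IH by (intro determined_on_Int) auto
    ultimately show ?case using insert.hyps IH by simp
  qed
  then show "measure uniform_bernoulli (\<Inter>v\<in>V. X v) = (\<Prod>v\<in>V. measure uniform_bernoulli (X v))"
    "determined_on (\<Union>v\<in>V. D v) (\<Inter>v\<in>V. X v)" by auto
qed

definition shift_config :: "int ^ 'd::finite \<Rightarrow> ('a, 'd) config \<Rightarrow> ('a, 'd) config" where
  "shift_config v x = (\<lambda>i. x (v + i))"

lemma determined_on_shift:
  assumes "determined_on D X"
  shows "determined_on ((+) v ` D) (shift_config v -` X)"
  unfolding determined_on_def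
proof (intro allI impI)
  fix x y assume "\<forall>i\<in>(+) v ` D. x i = y i" "x \<in> shift_config v -` X"
  then show "y \<in> shift_config v -` X"
    using determined_onD[OF assms, of "shift_config v x" "shift_config v y"] by (auto simp: shift_config_def)
qed

lemma measure_shift_determined_on:
  fixes X :: "('a::finite, 'd::finite) config set"
  assumes "finite D" "determined_on D X"
  shows "measure uniform_bernoulli (shift_config v -` X) = measure uniform_bernoulli X"
proof -
  have mem: "i \<in> (+) v ` D \<longleftrightarrow> i - v \<in> D" for i
  proof
    assume "i - v \<in> D"
    then show "i \<in> (+) v ` D" by (intro image_eqI[of _ _ "i - v"]) auto
  qed auto
  have "bij_betw (shift_config v) (shift_config v -` X \<inter> ((+) v ` D \<rightarrow>\<^sub>E UNIV)) (X \<inter> (D \<rightarrow>\<^sub>E UNIV))"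
  proof (rule bij_betwI[where g = "shift_config (- v)"])
    show "shift_config v \<in> shift_config v -` X \<inter> ((+) v ` D \<rightarrow>\<^sub>E UNIV) \<rightarrow> X \<inter> (D \<rightarrow>\<^sub>E UNIV)"
      by (auto simp: PiE_iff extensional_def mem) (simp add: shift_config_def mem)
    have "shift_config v (shift_config (- v) x) = x" "shift_config (- v) (shift_config v x) = x" for x :: "('a, 'd) config"
      by (simp_all add: shift_config_def)
    then show "shift_config (- v) \<in> X \<inter> (D \<rightarrow>\<^sub>E UNIV) \<rightarrow> shift_config v -` X \<inter> ((+) v ` D \<rightarrow>\<^sub>E UNIV)"
      by (auto simp: PiE_iff extensional_def mem) (simp add: shift_config_def)
  qed (auto simp: shift_config_def)
  then have "card (shift_config v -` X \<inter> ((+) v ` D \<rightarrow>\<^sub>E UNIV)) = card (X \<inter> (D \<rightarrow>\<^sub>E UNIV))"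
    by (rule bij_betw_same_card)
  then show ?thesis
    using measure_determined_on(1)[OF assms]
      measure_determined_on(1)[OF _ determined_on_shift[OF assms(2)], of v] assms(1)
    by (simp add: card_image)
qed

section \<open>Boxes in the lattice and two growth estimates\<close>

definition lattice_box :: "int \<Rightarrow> int \<Rightarrow> (int ^ 'd::finite) set" where
  "lattice_box l u = {x. \<forall>s. x $ s \<in> {l..u}}"

lemma card_lattice_box: "card (lattice_box l u :: (int ^ 'd::finite) set) = nat (u - l + 1) ^ CARD('d)"
  and finite_lattice_box: "finite (lattice_box l u :: (int ^ 'd) set)"
proof -
  have bij: "bij_betw vec_nth (lattice_box l u :: (int ^ 'd) set) (UNIV \<rightarrow>\<^sub>E {l..u})"
    by (rule bij_betwI[where g = vec_lambda]) (auto simp: lattice_box_def)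
  show "card (lattice_box l u :: (int ^ 'd) set) = nat (u - l + 1) ^ CARD('d)"
    using bij_betw_same_card[OF bij] by (simp add: card_PiE algebra_simps)
  show "finite (lattice_box l u :: (int ^ 'd) set)"
    using bij_betw_finite[OF bij] by (simp add: finite_PiE)
qed

lemma lattice_box_nth: "x \<in> lattice_box l u \<Longrightarrow> l \<le> x $ s \<and> x $ s \<le> u"
  by (simp add: lattice_box_def)

lemma lattice_box_add:
  assumes "x \<in> lattice_box l u" "y \<in> lattice_box l' u'" "l + l' = l''" "u + u' = u''"
  shows "x + y \<in> lattice_box l'' u''"
  unfolding lattice_box_def using lattice_box_nth[OF assms(1)] lattice_box_nth[OF assms(2)]
  by (auto simp: assms(3,4)[symmetric] intro: add_mono)

lemma lattice_box_mono: "l' \<le> l \<Longrightarrow> u \<le> u' \<Longrightarrow> lattice_box l u \<subseteq> lattice_box l' u'"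
  by (auto simp: lattice_box_def intro: order_trans)

lemma finite_subset_lattice_box:
  fixes S :: "(int ^ 'd::finite) set"
  assumes "finite S"
  obtains r :: nat where "S \<subseteq> lattice_box (- int r) (int r)"
proof
  let ?N = "(\<lambda>(x, s). nat \<bar>x $ s\<bar>) ` (S \<times> UNIV)"
  show "S \<subseteq> lattice_box (- int (Max ?N)) (int (Max ?N))"
  proof
    fix x assume "x \<in> S"
    then have "nat \<bar>x $ s\<bar> \<le> Max ?N" for s
      using assms by (intro Max_ge) force+
    then have "\<bar>x $ s\<bar> \<le> int (Max ?N)" for s
      by (metis nat_le_iff)
    then show "x \<in> lattice_box (- int (Max ?N)) (int (Max ?N))"
      by (auto simp: lattice_box_def abs_le_iff intro: minus_le_iff[THEN iffD1])
  qed
qed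

text \<open>
  Applied to side lengths \<open>b\<close> and \<open>b + h\<close> of concentric cubes in dimension \<open>Suc e\<close>, this
  bounds the boundary layer by a multiple of a power that is one lower than the volume.
\<close>

lemma power_add_le:
  fixes b h :: nat
  shows "(b + h) ^ Suc e \<le> b ^ Suc e + Suc e * h * (b + h) ^ e"
proof (induction e)
  case (Suc e)
  have "(b + h) ^ Suc (Suc e) = b * (b + h) ^ Suc e + h * (b + h) ^ Suc e"
    by (simp add: algebra_simps)
  also have "\<dots> \<le> b * (b ^ Suc e + Suc e * h * (b + h) ^ e) + h * (b + h) ^ Suc e"
    by (intro add_right_mono mult_left_mono Suc.IH) auto
  also have "\<dots> = b ^ Suc (Suc e) + Suc e * h * (b * (b + h) ^ e) + h * (b + h) ^ Suc e"
    by (simp add: algebra_simps)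
  also have "\<dots> \<le> b ^ Suc (Suc e) + Suc e * h * ((b + h) * (b + h) ^ e) + h * (b + h) ^ Suc e"
    by (intro add_mono mult_left_mono mult_right_mono) auto
  also have "\<dots> = b ^ Suc (Suc e) + Suc (Suc e) * h * (b + h) ^ Suc e"
    by (simp add: algebra_simps)
  finally show ?case .
qed simp

text \<open>
  A constant factor cannot compensate an exponential gap: this turns estimates for tensor powers
  into a sharp inequality for the base.
\<close>

lemma le_if_powers_le_const_mult:
  fixes p q A :: real
  assumes "0 \<le> q" "0 < A" and le: "\<And>k. k > 0 \<Longrightarrow> p ^ k \<le> q ^ k * A"
  shows "p \<le> q"
proof (rule ccontr)
  assume "\<not> p \<le> q"
  then have pq: "0 \<le> q / p" "q / p < 1" "0 < p" using assms(1) by (auto simp: field_simps)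
  obtain k where k: "(q / p) ^ k < 1 / A"
    using real_arch_pow_inv[of "1 / A" "q / p"] assms(2) pq by auto
  have "(q / p) ^ Suc k \<le> (q / p) ^ k" using pq by (intro power_decreasing) auto
  also note k
  finally have "(q / p) ^ Suc k * A < 1" using assms(2) by (simp only: pos_less_divide_eq)
  then have "q ^ Suc k * A < p ^ Suc k"
    using pq(3) by (simp add: power_divide divide_less_eq del: power_Suc)
  then show False using le[of "Suc k"] by simp
qed

section \<open>Surjective cellular automata preserve the uniform measure\<close>

lemma determined_on_mono: "determined_on D X \<Longrightarrow> D \<subseteq> E \<Longrightarrow> determined_on E X"
  unfolding determined_on_def by blast

locale local_map =
  fixes F :: "('a::finite, 'd::finite) config \<Rightarrow> ('a, 'd) config"
    and K :: "(int ^ 'd) set" and f :: "(int ^ 'd \<Rightarrow> 'a) \<Rightarrow> 'a"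
  assumes finite_K: "finite K" and local_rule: "F x m = f (restrict (\<lambda>k. x (m + k)) K)"
begin

lemma local_cong: "(\<And>k. k \<in> K \<Longrightarrow> x (m + k) = y (m + k)) \<Longrightarrow> F x m = F y m"
  unfolding local_rule by (metis (mono_tags, lifting) restrict_ext)

lemma shift_commute: "F (shift_config v x) = shift_config v (F x)"
  by (rule ext) (simp add: local_rule shift_config_def add.assoc)

lemma determined_on_vimage:
  assumes "determined_on B X" and "\<And>m k. m \<in> B \<Longrightarrow> k \<in> K \<Longrightarrow> m + k \<in> D"
  shows "determined_on D (F -` X)"
  unfolding determined_on_def
proof (intro allI impI)
  fix x y assume xy: "\<forall>i\<in>D. x i = y i" "x \<in> F -` X"
  have "F x m = F y m" if "m \<in> B" for m
    using xy(1) assms(2)[OF that] by (intro local_cong) auto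
  then show "y \<in> F -` X" using determined_onD[OF assms(1), of "F x" "F y"] xy(2) by auto
qed

lemma measurable_local_map: "F \<in> measurable uniform_bernoulli uniform_bernoulli"
proof -
  have "F \<in> measurable uniform_bernoulli (PiM UNIV (\<lambda>_. uniform_count_measure UNIV))"
  proof (rule measurable_PiM_single)
    fix A :: "'a set" and i :: "int ^ 'd"
    have "determined_on {i} {x. x i \<in> A}" by (auto simp: determined_on_def)
    then have "determined_on ((+) i ` K) (F -` {x. x i \<in> A})" by (rule determined_on_vimage) auto
    from measure_determined_on(2)[OF _ this]
    show "{\<omega> \<in> space uniform_bernoulli. F \<omega> i \<in> A} \<in> sets uniform_bernoulli"
      using finite_K by (simp add: vimage_def)
  qed (auto simp: space_uniform_count_measure)
  then show ?thesis by (simp add: uniform_bernoulli_def)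
qed

end

locale surjective_local_map = local_map F K f
  for F :: "('a::finite, 'd::finite) config \<Rightarrow> ('a, 'd) config" and K f +
  assumes surj: "surj F"
begin

text \<open>
  By surjectivity every pattern on \<open>B\<close> is the image of some pattern on a set \<open>D\<close> that contains
  the neighbourhood of \<open>B\<close>. Counting patterns, \<open>F -` X\<close> has at least as many as \<open>X\<close>, so only
  the normalisations, which differ by the cells of \<open>D\<close> beyond those of \<open>B\<close>, can make its measure
  smaller.
\<close>

lemma measure_le_vimage_boundary:
  assumes "finite B" "determined_on B X"
    and "finite D" "\<And>m k. m \<in> B \<Longrightarrow> k \<in> K \<Longrightarrow> m + k \<in> D"
  shows "measure uniform_bernoulli X * real CARD('a) ^ card B
       \<le> measure uniform_bernoulli (F -` X) * real CARD('a) ^ card D"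
proof -
  have "X \<inter> (B \<rightarrow>\<^sub>E UNIV) \<subseteq> (\<lambda>x. restrict (F x) B) ` (F -` X \<inter> (D \<rightarrow>\<^sub>E UNIV))"
  proof
    fix b assume b: "b \<in> X \<inter> (B \<rightarrow>\<^sub>E UNIV)"
    obtain z where z: "F z = b" using surj by (metis surjD)
    have eq: "F (restrict z D) m = b m" if "m \<in> B" for m
      unfolding z[symmetric] using that assms(4) by (intro local_cong) auto
    have "F (restrict z D) \<in> X \<longleftrightarrow> b \<in> X" by (rule determined_onD[OF assms(2) eq])
    moreover have "restrict (F (restrict z D)) B = b"
      using eq b by (auto simp: fun_eq_iff PiE_iff extensional_def restrict_def)
    ultimately show "b \<in> (\<lambda>x. restrict (F x) B) ` (F -` X \<inter> (D \<rightarrow>\<^sub>E UNIV))"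
      using b by (intro image_eqI[of _ _ "restrict z D"]) auto
  qed
  then have "card (X \<inter> (B \<rightarrow>\<^sub>E UNIV)) \<le> card (F -` X \<inter> (D \<rightarrow>\<^sub>E UNIV))"
    using assms(3) by (intro surj_card_le finite_Int disjI2 finite_PiE) auto
  then show ?thesis
    using measure_determined_on(1)[OF assms(1,2)]
      measure_determined_on(1)[OF assms(3) determined_on_vimage[OF assms(2,4)]]
    by simp
qed

text \<open>
  The tensor power trick. The crude boundary estimate is applied to the intersection \<open>T\<close> of
  \<open>k\<^sup>d\<close> translates of \<open>X\<close>. Independence turns both measures into \<open>k\<^sup>d\<close>-th powers, while
  the boundary costs only \<open>C * k\<^bsup>d-1\<^esup>\<close> cells. Taking \<open>k\<^bsup>d-1\<^esup>\<close>-th roots leaves an inequality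
  between \<open>k\<close>-th powers with a constant factor, which is harmless for large \<open>k\<close>.
\<close>

lemma measure_le_measure_vimage:
  assumes "finite D" "determined_on D X"
  shows "measure uniform_bernoulli X \<le> measure uniform_bernoulli (F -` X)"
proof -
  obtain r :: nat where r: "D \<union> K \<subseteq> lattice_box (- int r) (int r)"
    using finite_subset_lattice_box[of "D \<union> K"] assms(1) finite_K by auto
  \<comment> \<open>The spacing of the translates: preimages depend on boxes of side \<open>4 * r + 1\<close>, which then tile.\<close>
  define t where "t = 4 * r + 1"
  define C where "C = CARD('d) * (2 * r) * t ^ (CARD('d) - 1)"
  let ?N = "lattice_box (- 2 * int r) (2 * int r) :: (int ^ 'd) set"
  have DK: "m + k \<in> ?N" if "m \<in> D" "k \<in> K" for m k
    using r that by (intro lattice_box_add[of _ "- int r" "int r" _ "- int r" "int r"]) auto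
  have detN: "determined_on ?N (F -` X)" by (rule determined_on_vimage[OF assms(2) DK])
  have "measure uniform_bernoulli X ^ k
      \<le> measure uniform_bernoulli (F -` X) ^ k * real CARD('a) ^ C" if k: "k > 0" for k :: nat
  proof -
    let ?W = "lattice_box 0 (int k - 1) :: (int ^ 'd) set"
    let ?v = "\<lambda>w :: int ^ 'd. (\<chi> s. int t * w $ s)"
    let ?Y = "\<lambda>w. shift_config (?v w) -` X"
    let ?B = "lattice_box (- int r) (int t * (int k - 1) + int r) :: (int ^ 'd) set"
    let ?G = "lattice_box (- 2 * int r) (int t * (int k - 1) + 2 * int r) :: (int ^ 'd) set"
    define T where "T = (\<Inter>w\<in>?W. ?Y w)"
    have W: "finite ?W" "card ?W = k ^ CARD('d)" by (simp_all add: finite_lattice_box card_lattice_box)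
    have disjN: "disjoint_family_on (\<lambda>w. (+) (?v w) ` ?N) ?W"
      unfolding disjoint_family_on_def
    proof (intro ballI impI, rule ccontr)
      fix w w' assume "w \<noteq> w'" "(+) (?v w) ` ?N \<inter> (+) (?v w') ` ?N \<noteq> {}"
      then obtain n n' where n: "n \<in> ?N" "n' \<in> ?N" "?v w + n = ?v w' + n'" by auto
      have "w $ s = w' $ s" for s
      proof -
        have "int t * w $ s + n $ s = int t * w' $ s + n' $ s"
          using arg_cong[OF n(3), of "\<lambda>x. x $ s"] by simp
        then have eq: "int t * (w $ s - w' $ s) = n' $ s - n $ s" by (simp add: algebra_simps)
        have "\<bar>n' $ s - n $ s\<bar> < int t"
          using lattice_box_nth[OF n(1), of s] lattice_box_nth[OF n(2), of s]
          unfolding t_def by (simp add: abs_less_iff)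
        then have "int t * \<bar>w $ s - w' $ s\<bar> < int t * 1"
          unfolding eq[symmetric] by (simp add: abs_mult)
        then show ?thesis using mult_less_cancel_left_pos[of "int t"] by (simp add: t_def)
      qed
      then show False using \<open>w \<noteq> w'\<close> by (simp add: vec_eq_iff)
    qed
    have DN: "D \<subseteq> ?N"
      using r lattice_box_mono[of "- 2 * int r" "- int r" "int r" "2 * int r"] by auto
    have disjD: "disjoint_family_on (\<lambda>w. (+) (?v w) ` D) ?W"
      using disjN DN unfolding disjoint_family_on_def by blast
    note INT_D = measure_INT_determined_on[of ?W "\<lambda>w. (+) (?v w) ` D" ?Y,
        OF W(1) finite_imageI[OF assms(1)] determined_on_shift[OF assms(2)] disjD]
    note INT_N = measure_INT_determined_on[of ?W "\<lambda>w. (+) (?v w) ` ?N"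
          "\<lambda>w. shift_config (?v w) -` (F -` X)",
        OF W(1) finite_imageI[OF finite_lattice_box] determined_on_shift[OF detN] disjN]
    have detT: "determined_on (\<Union>w\<in>?W. (+) (?v w) ` D) T"
      unfolding T_def by (rule INT_D(2))
    have "measure uniform_bernoulli T = (\<Prod>w\<in>?W. measure uniform_bernoulli (?Y w))"
      unfolding T_def by (rule INT_D(1))
    then have mT: "measure uniform_bernoulli T = measure uniform_bernoulli X ^ (k ^ CARD('d))"
      by (simp add: measure_shift_determined_on[OF assms] W)
    have FT: "F -` T = (\<Inter>w\<in>?W. shift_config (?v w) -` (F -` X))"
      by (auto simp: T_def shift_commute)
    have "measure uniform_bernoulli (F -` T)
        = (\<Prod>w\<in>?W. measure uniform_bernoulli (shift_config (?v w) -` (F -` X)))"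
      unfolding FT by (rule INT_N(1))
    then have mFT: "measure uniform_bernoulli (F -` T)
        = measure uniform_bernoulli (F -` X) ^ (k ^ CARD('d))"
      by (simp add: measure_shift_determined_on[OF finite_lattice_box detN] W)
    have "(+) (?v w) ` D \<subseteq> ?B" if "w \<in> ?W" for w
    proof
      fix i assume "i \<in> (+) (?v w) ` D"
      then obtain n where n: "n \<in> lattice_box (- int r) (int r)" "i = ?v w + n" using r by auto
      have "- int r \<le> i $ s \<and> i $ s \<le> int t * (int k - 1) + int r" for s
      proof -
        have "0 \<le> w $ s" "w $ s \<le> int k - 1" "- int r \<le> n $ s" "n $ s \<le> int r"
          using that n(1) by (auto simp: lattice_box_def)
        moreover have "0 \<le> int t * w $ s" "int t * w $ s \<le> int t * (int k - 1)"
          using calculation by (auto intro: mult_left_mono)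
        ultimately show ?thesis
          unfolding n(2) vector_add_component vec_lambda_beta by (intro conjI; linarith)
      qed
      then show "i \<in> ?B" by (simp add: lattice_box_def)
    qed
    then have detB: "determined_on ?B T" by (intro determined_on_mono[OF detT]) auto
    have "m + j \<in> ?G" if "m \<in> ?B" "j \<in> K" for m j
      using r that by (intro lattice_box_add[OF that(1), of _ "- int r" "int r"]) auto
    from measure_le_vimage_boundary[OF finite_lattice_box detB finite_lattice_box this]
    have le: "measure uniform_bernoulli T * real CARD('a) ^ card ?B
        \<le> measure uniform_bernoulli (F -` T) * real CARD('a) ^ card ?G" .
    obtain e where e: "CARD('d) = Suc e" by (metis not0_implies_Suc zero_less_card_finite less_irrefl)
    have tk: "2 * r \<le> t * k" using k by (cases k) (auto simp: t_def)
    have "int t * (int k - 1) + 2 * int r - (- 2 * int r) + 1 = int (t * k)"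
      by (simp add: t_def algebra_simps)
    then have "card ?G = (t * k) ^ Suc e"
      unfolding card_lattice_box e by (simp only: nat_int)
    moreover have "int t * (int k - 1) + int r - (- int r) + 1 = int (t * k - 2 * r)"
      using tk by (simp add: t_def algebra_simps of_nat_diff)
    then have "card ?B = (t * k - 2 * r) ^ Suc e"
      unfolding card_lattice_box e by (simp only: nat_int)
    ultimately have "card ?G \<le> card ?B + C * k ^ e"
      using power_add_le[of "t * k - 2 * r" "2 * r" e] tk
      by (simp add: C_def e power_mult_distrib mult_ac del: power_Suc)
    then have "real CARD('a) ^ card ?G \<le> real CARD('a) ^ (card ?B + C * k ^ e)"
      by (intro power_increasing) (auto simp: Suc_le_eq)
    with le have "measure uniform_bernoulli T * real CARD('a) ^ card ?B
        \<le> measure uniform_bernoulli (F -` T) * real CARD('a) ^ (card ?B + C * k ^ e)"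
      by (meson measure_nonneg mult_left_mono order_trans)
    then have "measure uniform_bernoulli T
        \<le> measure uniform_bernoulli (F -` T) * real CARD('a) ^ (C * k ^ e)"
      by (simp add: power_add mult_ac)
    then have "(measure uniform_bernoulli X ^ k) ^ (k ^ e)
        \<le> (measure uniform_bernoulli (F -` X) ^ k * real CARD('a) ^ C) ^ (k ^ e)"
      unfolding mT mFT e by (simp add: power_mult power_mult_distrib)
    then show ?thesis
      using k by (subst (asm) power_mono_iff) auto
  qed
  note powers = this
  show ?thesis by (rule le_if_powers_le_const_mult[OF measure_nonneg _ powers]) simp
qed

text \<open>
  The complement of an event determined on \<open>D\<close> is again determined on \<open>D\<close>, and mass cannot grow
  on both sides.
\<close>

lemma measure_vimage_determined_on:
  assumes "finite D" "determined_on D X"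
  shows "measure uniform_bernoulli (F -` X) = measure uniform_bernoulli X"
proof -
  have X: "X \<in> sets uniform_bernoulli" using measure_determined_on(2)[OF assms] .
  then have FX: "F -` X \<in> sets uniform_bernoulli"
    using measurable_sets[OF measurable_local_map X] by simp
  have "measure uniform_bernoulli (- X) \<le> measure uniform_bernoulli (- (F -` X))"
    using measure_le_measure_vimage[OF assms(1) determined_on_compl[OF assms(2)]]
    by (simp add: vimage_Compl)
  then have "measure uniform_bernoulli (F -` X) \<le> measure uniform_bernoulli X"
    using bernoulli.prob_compl[OF X] bernoulli.prob_compl[OF FX] by (simp add: Compl_eq_Diff_UNIV)
  then show ?thesis using measure_le_measure_vimage[OF assms] by simp
qed

lemma distr_uniform_bernoulli: "distr uniform_bernoulli uniform_bernoulli F = uniform_bernoulli"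
proof (rule measure_eqI_PiM_infinite)
  show "finite_measure (distr uniform_bernoulli uniform_bernoulli F)"
    by (intro bernoulli.finite_measure_distr measurable_local_map)
next
  fix A :: "int ^ 'd \<Rightarrow> 'a set" and J :: "(int ^ 'd) set"
  assume J: "finite J"
  let ?X = "prod_emb UNIV (\<lambda>_ :: int ^ 'd. uniform_count_measure (UNIV :: 'a set)) J (Pi\<^sub>E J A)"
  have det: "determined_on J ?X"
    by (auto simp: determined_on_def prod_emb_def space_uniform_count_measure PiE_iff)
  show "emeasure (distr uniform_bernoulli uniform_bernoulli F) ?X = emeasure uniform_bernoulli ?X"
    using measure_vimage_determined_on[OF J det] measure_determined_on(2)[OF J det]
    by (simp add: emeasure_distr measurable_local_map bernoulli.emeasure_eq_measure)
qed (auto simp: uniform_bernoulli_def)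

end

section \<open>Periodicity of coordinates at equicontinuity points\<close>

lemma eq_at_if_config_dist_less:
  assumes "config_dist x y < 1 / 2 ^ lattice_norm i"
  shows "x i = y i"
proof (rule ccontr)
  assume neq: "x i \<noteq> y i"
  then have "Inf {lattice_norm i | i. x i \<noteq> y i} \<le> lattice_norm i"
    by (intro wellorder_Inf_le1) blast
  then have "(1 :: real) / 2 ^ lattice_norm i \<le> 1 / 2 ^ Inf {lattice_norm i | i. x i \<noteq> y i}"
    by (intro divide_left_mono power_increasing) auto
  moreover have "x \<noteq> y" using neq by auto
  ultimately show False using assms by (simp add: config_dist_def)
qed

lemma config_dist_less_if_eq_on_ball:
  assumes "\<And>i. lattice_norm i \<le> n \<Longrightarrow> x i = y i"
  shows "config_dist x y < 1 / 2 ^ n"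
proof (cases "x = y")
  case False
  let ?N = "{lattice_norm i | i. x i \<noteq> y i}"
  from False have "?N \<noteq> {}" by auto
  then have "Inf ?N \<in> ?N" by (rule Inf_nat_def1)
  then obtain i where "Inf ?N = lattice_norm i" "x i \<noteq> y i" by auto
  then have "n < Inf ?N" using assms[of i] by (auto simp: not_le[symmetric])
  then have "(1 :: real) / 2 ^ Inf ?N < 1 / 2 ^ n"
    by (intro divide_strict_left_mono power_strict_increasing) auto
  then show ?thesis using False by (simp add: config_dist_def)
qed (simp add: config_dist_def)

lemma finite_lattice_ball: "finite {i :: int ^ 'd::finite. lattice_norm i \<le> n}"
proof (rule finite_subset[OF _ finite_lattice_box])
  show "{i :: int ^ 'd. lattice_norm i \<le> n} \<subseteq> lattice_box (- int n) (int n)"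
  proof
    fix i :: "int ^ 'd" assume "i \<in> {i. lattice_norm i \<le> n}"
    then have "nat \<bar>i $ s\<bar> \<le> n" for s by (auto simp: lattice_norm_def)
    then have "\<bar>i $ s\<bar> \<le> int n" for s by (metis nat_le_iff)
    then show "i \<in> lattice_box (- int n) (int n)"
      by (auto simp: lattice_box_def abs_le_iff intro: minus_le_iff[THEN iffD1])
  qed
qed

context surjective_local_map
begin

lemma measurable_funpow:
  "F ^^ n \<in> measurable uniform_bernoulli uniform_bernoulli"
proof (induction n)
  case (Suc n)
  show ?case unfolding funpow.simps by (rule measurable_comp[OF Suc measurable_local_map])
qed (simp add: id_def)

lemma distr_funpow: "distr uniform_bernoulli uniform_bernoulli (F ^^ n) = uniform_bernoulli"
proof (induction n)
  case (Suc n)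
  have "distr uniform_bernoulli uniform_bernoulli (F ^^ Suc n)
      = distr (distr uniform_bernoulli uniform_bernoulli (F ^^ n)) uniform_bernoulli F"
    by (subst distr_distr) (auto intro: measurable_local_map measurable_funpow)
  then show ?case unfolding Suc distr_uniform_bernoulli .
qed (simp add: id_def distr_id)

lemma measure_funpow_vimage:
  assumes "B \<in> sets uniform_bernoulli"
  shows "measure uniform_bernoulli ((F ^^ n) -` B) = measure uniform_bernoulli B"
  using measure_distr[OF measurable_funpow assms, of n] by (simp add: distr_funpow)

lemma funpow_vimage_sets:
  "B \<in> sets uniform_bernoulli \<Longrightarrow> (F ^^ n) -` B \<in> sets uniform_bernoulli"
  using measurable_sets[OF measurable_funpow, of B n] by simp

text \<open>
  Poincare recurrence in its weakest form: the preimages of \<open>C\<close> all have the same positive measure,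
  so infinitely many of them do not fit disjointly into a probability space.
\<close>

lemma recurrence:
  assumes "C \<in> sets uniform_bernoulli" "measure uniform_bernoulli C > 0"
  obtains p y where "p > 0" "y \<in> C" "(F ^^ p) y \<in> C"
proof -
  have "\<exists>p y. p > 0 \<and> y \<in> C \<and> (F ^^ p) y \<in> C"
  proof (rule ccontr)
    assume none: "\<not> (\<exists>p y. p > 0 \<and> y \<in> C \<and> (F ^^ p) y \<in> C)"
    have "(F ^^ i) -` C \<inter> (F ^^ j) -` C = {}" if "i < j" for i j
    proof -
      have "(F ^^ j) x = (F ^^ (j - i)) ((F ^^ i) x)" for x
        using that by (simp flip: funpow_add comp_apply[of "F ^^ (j - i)"])
      then show ?thesis using none that by (auto dest: spec[of _ "j - i"])
    qed
    then have "disjoint_family_on (\<lambda>n. (F ^^ n) -` C) {..<N}" for N :: nat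
      unfolding disjoint_family_on_def by (intro ballI impI) (erule linorder_neqE_nat; blast)
    then have "measure uniform_bernoulli (\<Union>n<N. (F ^^ n) -` C)
        = (\<Sum>n<N. measure uniform_bernoulli ((F ^^ n) -` C))" for N
      using assms(1) funpow_vimage_sets by (intro bernoulli.finite_measure_finite_Union) auto
    then have "real N * measure uniform_bernoulli C
        = measure uniform_bernoulli (\<Union>n<N. (F ^^ n) -` C)" for N
      by (simp add: measure_funpow_vimage[OF assms(1)])
    then have "real N * measure uniform_bernoulli C \<le> 1" for N
      using bernoulli.prob_le_1 by simp
    moreover obtain N where "1 < real N * measure uniform_bernoulli C"
      using reals_Archimedean3[OF assms(2)] by blast
    ultimately show False by (meson not_le)
  qed
  then show ?thesis using that by blast
qed

text \<open>
  Near \<open>x\<close> all points have the same history at cell \<open>i\<close>. If \<open>y\<close> and \<open>(F ^^ p) y\<close> are both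
  near \<open>x\<close>, then this common history also equals itself delayed by \<open>p\<close>.
\<close>

lemma coordinate_periodic_at_equicontinuity_point:
  assumes "equicontinuity_point F x"
  obtains p where "p > 0" "\<And>k. (F ^^ (k + p)) x i = (F ^^ k) x i"
proof -
  have "(0 :: real) < 1 / 2 ^ lattice_norm i" by simp
  with assms obtain \<delta> where \<delta>: "\<delta> > 0"
    "\<And>y n. config_dist x y < \<delta> \<Longrightarrow> config_dist ((F ^^ n) x) ((F ^^ n) y) < 1 / 2 ^ lattice_norm i"
    unfolding equicontinuity_point_def by meson
  obtain n where n: "1 / 2 ^ n < \<delta>"
    using real_arch_pow_inv[of \<delta> "1 / 2"] \<delta>(1) by (auto simp: power_one_over)
  let ?S = "{i :: int ^ 'd. lattice_norm i \<le> n}"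
  define C where "C = {y. \<forall>i\<in>?S. y i = x i}"
  have orbit: "(F ^^ k) y i = (F ^^ k) x i" if "y \<in> C" for k y
  proof -
    have "config_dist x y < 1 / 2 ^ n"
      using that by (intro config_dist_less_if_eq_on_ball) (auto simp: C_def)
    then show ?thesis using \<delta>(2) n by (intro eq_at_if_config_dist_less[symmetric]) auto
  qed
  have "C \<in> sets uniform_bernoulli"
    unfolding C_def by (rule measure_cylinder(2)[OF finite_lattice_ball])
  moreover have "measure uniform_bernoulli C > 0"
    unfolding C_def by (subst measure_cylinder(1)[OF finite_lattice_ball]) simp
  ultimately obtain p y where p: "p > 0" "y \<in> C" "(F ^^ p) y \<in> C" by (rule recurrence)
  have "(F ^^ (k + p)) x i = (F ^^ k) x i" for k
  proof -
    have "(F ^^ (k + p)) x i = (F ^^ (k + p)) y i" using orbit[OF p(2)] by simp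
    also have "\<dots> = (F ^^ k) ((F ^^ p) y) i" by (simp add: funpow_add)
    also have "\<dots> = (F ^^ k) x i" by (rule orbit[OF p(3)])
    finally show ?thesis .
  qed
  with p(1) show ?thesis by (rule that)
qed

section \<open>Near-periodicity of measurable events\<close>

definition deviation :: "('a, 'd) config set \<Rightarrow> ('a, 'd) config set \<Rightarrow> nat \<Rightarrow> ('a, 'd) config set" where
  "deviation X B n = {x \<in> X. ((F ^^ n) x \<in> B) \<noteq> (x \<in> B)}"

text \<open>
  The bound is required for all multiples of \<open>P\<close> at once. This makes the property stable under
  passing to multiples of \<open>P\<close>, so finitely many events have a common near-period, and it leaves a
  multiple to be chosen freely afterwards.
\<close>

definition nearly_periodic_on :: "('a, 'd) config set \<Rightarrow> ('a, 'd) config set \<Rightarrow> bool" where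
  "nearly_periodic_on X B \<longleftrightarrow>
     (\<forall>\<epsilon>>0. \<exists>P>0. \<forall>j. measure uniform_bernoulli (deviation X B (j * P)) < \<epsilon>)"

lemma deviation_sets:
  assumes "X \<in> sets uniform_bernoulli" "B \<in> sets uniform_bernoulli"
  shows "deviation X B n \<in> sets uniform_bernoulli"
proof -
  have "deviation X B n = X \<inter> (((F ^^ n) -` B - B) \<union> (B - (F ^^ n) -` B))"
    by (auto simp: deviation_def)
  then show ?thesis using assms funpow_vimage_sets[OF assms(2)] by auto
qed

lemma nearly_periodic_on_common_period:
  assumes "nearly_periodic_on X B" "nearly_periodic_on X C" "\<epsilon> > 0"
  obtains P where "P > 0"
    "\<And>j. measure uniform_bernoulli (deviation X B (j * P)) < \<epsilon>"
    "\<And>j. measure uniform_bernoulli (deviation X C (j * P)) < \<epsilon>"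
proof -
  obtain P Q where P: "P > 0" "\<And>j. measure uniform_bernoulli (deviation X B (j * P)) < \<epsilon>"
    and Q: "Q > 0" "\<And>j. measure uniform_bernoulli (deviation X C (j * Q)) < \<epsilon>"
    using assms unfolding nearly_periodic_on_def by meson
  show ?thesis
  proof (rule that[of "P * Q"])
    show "measure uniform_bernoulli (deviation X B (j * (P * Q))) < \<epsilon>" for j
      using P(2)[of "j * Q"] by (simp add: mult_ac)
    show "measure uniform_bernoulli (deviation X C (j * (P * Q))) < \<epsilon>" for j
      using Q(2)[of "j * P"] by (simp add: mult_ac)
  qed (use P Q in simp)
qed

lemma nearly_periodic_on_Un:
  assumes "nearly_periodic_on X B" "nearly_periodic_on X C"
    and "X \<in> sets uniform_bernoulli" "B \<in> sets uniform_bernoulli" "C \<in> sets uniform_bernoulli"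
  shows "nearly_periodic_on X (B \<union> C)"
  unfolding nearly_periodic_on_def
proof (intro allI impI)
  fix \<epsilon> :: real assume "\<epsilon> > 0"
  then obtain P where P: "P > 0"
    "\<And>j. measure uniform_bernoulli (deviation X B (j * P)) < \<epsilon> / 2"
    "\<And>j. measure uniform_bernoulli (deviation X C (j * P)) < \<epsilon> / 2"
    using nearly_periodic_on_common_period[OF assms(1,2), of "\<epsilon> / 2"] by auto
  have "measure uniform_bernoulli (deviation X (B \<union> C) (j * P)) < \<epsilon>" for j
  proof -
    have "measure uniform_bernoulli (deviation X (B \<union> C) (j * P))
        \<le> measure uniform_bernoulli (deviation X B (j * P) \<union> deviation X C (j * P))"
      using assms(3-5) by (intro bernoulli.finite_measure_mono sets.Un deviation_sets)
        (auto simp: deviation_def)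
    also have "\<dots> \<le> measure uniform_bernoulli (deviation X B (j * P))
        + measure uniform_bernoulli (deviation X C (j * P))"
      using assms(3-5) by (intro measure_Un_le deviation_sets)
    also have "\<dots> < \<epsilon>" using P(2,3)[of j] by simp
    finally show ?thesis .
  qed
  with P(1) show "\<exists>P>0. \<forall>j. measure uniform_bernoulli (deviation X (B \<union> C) (j * P)) < \<epsilon>"
    by blast
qed

text \<open>
  A countable union differs from one of its finite subunions by a set \<open>R\<close> of small measure; the
  preimage of \<open>R\<close> is just as small because \<open>F\<close> preserves the measure.
\<close>

lemma nearly_periodic_on_UN:
  fixes B :: "nat \<Rightarrow> ('a, 'd) config set"
  assumes "X \<in> sets uniform_bernoulli"
    and "\<And>n. B n \<in> sets uniform_bernoulli" "\<And>n. nearly_periodic_on X (B n)"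
  shows "nearly_periodic_on X (\<Union>n. B n)"
  unfolding nearly_periodic_on_def
proof (intro allI impI)
  fix \<epsilon> :: real assume \<epsilon>: "\<epsilon> > 0"
  let ?U = "\<Union>n. B n" and ?V = "\<lambda>N. \<Union>n<N. B n"
  have V: "?V N \<in> sets uniform_bernoulli" "nearly_periodic_on X (?V N)" for N
  proof -
    show "?V N \<in> sets uniform_bernoulli" for N using assms(2) by auto
    then show "nearly_periodic_on X (?V N)"
    proof (induction N)
      case 0
      show ?case by (auto simp: nearly_periodic_on_def deviation_def)
    next
      case (Suc N)
      then show ?case using assms nearly_periodic_on_Un[of X "B N" "?V N"]
        by (simp add: lessThan_Suc)
    qed
  qed
  have "(\<lambda>N. measure uniform_bernoulli (?V N)) \<longlonglongrightarrow> measure uniform_bernoulli (\<Union>N. ?V N)"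
    using V(1) by (intro bernoulli.finite_Lim_measure_incseq) (force simp: incseq_def)+
  moreover have "(\<Union>N. ?V N) = ?U" by auto
  ultimately have "\<forall>\<^sub>F N in sequentially.
      measure uniform_bernoulli ?U - \<epsilon> / 3 < measure uniform_bernoulli (?V N)"
    using \<epsilon> by (intro order_tendstoD(1)) auto
  then obtain N where N: "measure uniform_bernoulli ?U - \<epsilon> / 3 < measure uniform_bernoulli (?V N)"
    by (auto simp: eventually_sequentially)
  define R where "R = ?U - ?V N"
  have R: "R \<in> sets uniform_bernoulli" using assms(2) unfolding R_def by auto
  have mR: "measure uniform_bernoulli R < \<epsilon> / 3"
    unfolding R_def using N assms(2) by (subst bernoulli.finite_measure_Diff) auto
  obtain P where P: "P > 0" "\<And>j. measure uniform_bernoulli (deviation X (?V N) (j * P)) < \<epsilon> / 3"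
    using V(2)[of N] \<epsilon> unfolding nearly_periodic_on_def by (meson divide_pos_pos zero_less_numeral)
  have "measure uniform_bernoulli (deviation X ?U (j * P)) < \<epsilon>" for j
  proof -
    have "measure uniform_bernoulli (deviation X ?U (j * P))
        \<le> measure uniform_bernoulli (deviation X (?V N) (j * P) \<union> (R \<union> (F ^^ (j * P)) -` R))"
      using assms(1) V(1) R
      by (intro bernoulli.finite_measure_mono sets.Un deviation_sets funpow_vimage_sets)
        (auto simp: deviation_def R_def)
    also have "\<dots> \<le> measure uniform_bernoulli (deviation X (?V N) (j * P))
        + measure uniform_bernoulli (R \<union> (F ^^ (j * P)) -` R)"
      using assms(1) V(1) R by (intro measure_Un_le deviation_sets sets.Un funpow_vimage_sets)
    also have "measure uniform_bernoulli (R \<union> (F ^^ (j * P)) -` R)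
        \<le> measure uniform_bernoulli R + measure uniform_bernoulli ((F ^^ (j * P)) -` R)"
      using R by (intro measure_Un_le funpow_vimage_sets)
    also have "measure uniform_bernoulli ((F ^^ (j * P)) -` R) = measure uniform_bernoulli R"
      by (rule measure_funpow_vimage[OF R])
    finally show ?thesis using P(2)[of j] mR by simp
  qed
  with P(1) show "\<exists>P>0. \<forall>j. measure uniform_bernoulli (deviation X ?U (j * P)) < \<epsilon>"
    by blast
qed

text \<open>
  Every point of \<open>X\<close> has some period at cell \<open>i\<close>, hence also period \<open>fact m\<close> for all large
  \<open>m\<close>. The sets \<open>Q m\<close> of points that return at all multiples of \<open>fact m\<close> therefore increase
  to \<open>X\<close>.
\<close>

lemma nearly_periodic_on_coordinate_event:
  assumes X: "X \<in> sets uniform_bernoulli" and eq: "\<And>x. x \<in> X \<Longrightarrow> equicontinuity_point F x"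
  shows "nearly_periodic_on X {x. x i \<in> A}"
  unfolding nearly_periodic_on_def
proof (intro allI impI)
  fix \<epsilon> :: real assume \<epsilon>: "\<epsilon> > 0"
  define Q where "Q m = {x \<in> X. \<forall>j. (F ^^ (j * fact m)) x i = x i}" for m :: nat
  have coord: "{x :: ('a, 'd) config. x i = a} \<in> sets uniform_bernoulli" for a
    by (rule measure_determined_on(2)[of "{i}"]) (auto simp: determined_on_def)
  have return_sets: "{x. (F ^^ n) x i = x i} \<in> sets uniform_bernoulli" for n
  proof -
    have "{x. (F ^^ n) x i = x i} = (\<Union>a. (F ^^ n) -` {x. x i = a} \<inter> {x. x i = a})" by auto
    also have "\<dots> \<in> sets uniform_bernoulli"
      by (intro sets.finite_UN sets.Int funpow_vimage_sets coord finite_class.finite_UNIV)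
    finally show ?thesis .
  qed
  have Q_sets: "Q m \<in> sets uniform_bernoulli" for m
  proof -
    have "Q m = X \<inter> (\<Inter>j. {x. (F ^^ (j * fact m)) x i = x i})" by (auto simp: Q_def)
    also have "\<dots> \<in> sets uniform_bernoulli"
      using return_sets by (intro sets.Int X sets.countable_INT) auto
    finally show ?thesis .
  qed
  have "incseq Q"
  proof (rule incseq_SucI, rule subsetI)
    fix m x assume x: "x \<in> Q m"
    have "(F ^^ (j * fact (Suc m))) x i = x i" for j
    proof -
      have "j * fact (Suc m) = (j * Suc m) * fact m" by (simp add: algebra_simps)
      then show ?thesis using x unfolding Q_def by (metis (mono_tags, lifting) mem_Collect_eq)
    qed
    then show "x \<in> Q (Suc m)" using x by (simp add: Q_def)
  qed
  then have "(\<lambda>m. measure uniform_bernoulli (Q m)) \<longlonglongrightarrow> measure uniform_bernoulli (\<Union>m. Q m)"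
    using Q_sets by (intro bernoulli.finite_Lim_measure_incseq) auto
  moreover have "(\<Union>m. Q m) = X"
  proof
    show "X \<subseteq> (\<Union>m. Q m)"
    proof
      fix x assume x: "x \<in> X"
      obtain p where p: "p > 0" "\<And>k. (F ^^ (k + p)) x i = (F ^^ k) x i"
        using coordinate_periodic_at_equicontinuity_point[OF eq[OF x]] by metis
      have mult: "(F ^^ (q * p)) x i = x i" for q
      proof (induction q)
        case (Suc q)
        then show ?case using p(2)[of "q * p"] by (simp add: add.commute)
      qed simp
      have "p dvd fact p" using p(1) by (intro dvd_fact) auto
      then obtain c where "fact p = p * c" ..
      then have "(F ^^ (j * fact p)) x i = x i" for j
        using mult[of "j * c"] by (simp add: mult_ac)
      then show "x \<in> (\<Union>m. Q m)" using x by (auto simp: Q_def)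
    qed
  qed (auto simp: Q_def)
  ultimately have "\<forall>\<^sub>F m in sequentially.
      measure uniform_bernoulli X - \<epsilon> < measure uniform_bernoulli (Q m)"
    using \<epsilon> by (intro order_tendstoD(1)) auto
  then obtain m where "measure uniform_bernoulli X - \<epsilon> < measure uniform_bernoulli (Q m)"
    by (auto simp: eventually_sequentially)
  then have small: "measure uniform_bernoulli (X - Q m) < \<epsilon>"
    using X Q_sets by (subst bernoulli.finite_measure_Diff) (auto simp: Q_def)
  have "measure uniform_bernoulli (deviation X {x. x i \<in> A} (j * fact m)) < \<epsilon>" for j
  proof -
    have "deviation X {x. x i \<in> A} (j * fact m) \<subseteq> X - Q m"
      by (auto simp: deviation_def Q_def)
    then have "measure uniform_bernoulli (deviation X {x. x i \<in> A} (j * fact m))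
        \<le> measure uniform_bernoulli (X - Q m)"
      using X Q_sets by (intro bernoulli.finite_measure_mono) auto
    then show ?thesis using small by simp
  qed
  then show "\<exists>P>0. \<forall>j. measure uniform_bernoulli (deviation X {x. x i \<in> A} (j * P)) < \<epsilon>"
    by (intro exI[of _ "fact m"]) auto
qed

text \<open>
  The events in question contain the generators of the sigma-algebra and are closed under
  complements and countable unions.
\<close>

lemma nearly_periodic_on_measurable:
  assumes X: "X \<in> sets uniform_bernoulli" and eq: "\<And>x. x \<in> X \<Longrightarrow> equicontinuity_point F x"
    and B: "B \<in> sets uniform_bernoulli"
  shows "nearly_periodic_on X B"
proof -
  let ?G = "{{x :: ('a, 'd) config. x i \<in> A} | i A. True}"
  have sigma: "sets uniform_bernoulli = sigma_sets UNIV ?G"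
    unfolding uniform_bernoulli_def sets_PiM_single
    by (simp add: sets_uniform_count_measure space_uniform_count_measure)
  from B show ?thesis
    unfolding sigma
  proof (induction rule: sigma_sets.induct)
    case (Basic B)
    then show ?case using nearly_periodic_on_coordinate_event[OF X eq] by auto
  next
    case Empty
    show ?case by (auto simp: nearly_periodic_on_def deviation_def)
  next
    case (Compl B)
    have "deviation X (UNIV - B) = deviation X B" by (auto simp: deviation_def fun_eq_iff)
    then have "nearly_periodic_on X (UNIV - B) = nearly_periodic_on X B"
      by (simp only: nearly_periodic_on_def)
    with Compl.IH show ?case by (simp only:)
  next
    case (Union B)
    show ?case
    proof (rule nearly_periodic_on_UN[OF X])
      show "B n \<in> sets uniform_bernoulli" for n unfolding sigma by (rule Union.hyps)
      show "nearly_periodic_on X (B n)" for n by (rule Union.IH)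
    qed
  qed
qed

end

section \<open>Rotations of the complex plane\<close>

text \<open>
  If all powers stayed in the right half-plane, repeated squaring would at least double the distance
  of the real part from 1 at every step, although that distance never exceeds 1.
\<close>

lemma unit_power_in_left_half_plane:
  fixes w :: complex
  assumes "norm w = 1" "w \<noteq> 1"
  obtains j where "Re (w ^ j) < 0"
proof -
  have "\<exists>j. Re (w ^ j) < 0"
  proof (rule ccontr)
    assume "\<not> (\<exists>j. Re (w ^ j) < 0)"
    then have nonneg: "Re (w ^ j) \<ge> 0" for j by (simp add: not_less)
    have doubling: "2 * (1 - Re z) \<le> 1 - Re (z ^ 2)" if "norm z = 1" "Re z \<ge> 0" for z
    proof -
      have "Re z ^ 2 + Im z ^ 2 = 1" using that(1) cmod_power2[of z] by simp
      then have "1 - Re (z ^ 2) = 2 * (1 - Re z) * (1 + Re z)"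
        by (simp add: power2_eq_square algebra_simps)
      moreover have "Re z \<le> 1" using complex_Re_le_cmod[of z] that(1) by simp
      ultimately show ?thesis using that(2) by (simp add: mult_le_cancel_left1)
    qed
    have grow: "2 ^ n * (1 - Re w) \<le> 1 - Re (w ^ (2 ^ n))" for n
    proof (induction n)
      case (Suc n)
      have "2 * (1 - Re (w ^ 2 ^ n)) \<le> 1 - Re ((w ^ 2 ^ n) ^ 2)"
        using assms(1) nonneg by (intro doubling) (auto simp: norm_power)
      then show ?case using Suc by (simp add: power_mult[symmetric] mult.commute)
    qed simp
    have "Re w \<noteq> 1"
    proof
      assume "Re w = 1"
      moreover then have "Im w = 0" using assms(1) cmod_power2[of w] by simp
      ultimately show False using assms(2) by (simp add: complex_eq_iff)
    qed
    then have "0 < 1 - Re w" using complex_Re_le_cmod[of w] assms(1) by simp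
    then obtain n where "1 / (1 - Re w) < 2 ^ n" using real_arch_pow[of 2] by auto
    then have "1 < 2 ^ n * (1 - Re w)" using \<open>0 < 1 - Re w\<close> by (simp add: field_simps)
    then show False using grow[of n] nonneg[of "2 ^ n"] by simp
  qed
  then show ?thesis using that by blast
qed

text \<open>
  If \<open>z\<close> and \<open>w * z\<close> lay in the same quadrant, their real inner product, which is
  \<open>Re w\<close> times the squared modulus of \<open>z\<close>, would be nonnegative.
\<close>

lemma quadrant_changes:
  fixes w z :: complex
  assumes "Re w < 0" "z \<noteq> 0"
  shows "(0 \<le> Re (w * z)) \<noteq> (0 \<le> Re z) \<or> (0 \<le> Im (w * z)) \<noteq> (0 \<le> Im z)"
proof (rule ccontr)
  assume "\<not> ?thesis"
  then have "0 \<le> Re (w * z) * Re z" "0 \<le> Im (w * z) * Im z"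
    by (auto simp: zero_le_mult_iff)
  moreover have "Re (w * z) * Re z + Im (w * z) * Im z = Re w * (Re z ^ 2 + Im z ^ 2)"
    by (simp add: power2_eq_square algebra_simps)
  moreover have "Re w * (Re z ^ 2 + Im z ^ 2) < 0"
    using assms by (intro mult_neg_pos) (auto simp: complex_neq_0)
  ultimately show False by simp
qed

lemma exp_power_eq_1_rational:
  assumes "exp (2 * of_real pi * \<i> * of_real \<alpha>) ^ P = (1 :: complex)" "P > 0"
  shows "\<alpha> \<in> \<rat>"
proof -
  have "exp (of_nat P * (2 * of_real pi * \<i> * of_real \<alpha>)) = (1 :: complex)"
    using assms(1) by (simp add: exp_of_nat_mult)
  then obtain n :: int where "real P * (2 * pi * \<alpha>) = of_int (2 * n) * pi"
    unfolding exp_eq_1 by auto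
  then have "\<alpha> = of_int n / of_nat P" using assms(2) by (simp add: field_simps)
  then show ?thesis by (simp add: Rats_divide)
qed

section \<open>Eigenvalues whose eigenfunctions do not vanish at equicontinuity points\<close>

theorem proposition17:
  fixes F :: "('a::finite, 'd::finite) config \<Rightarrow> ('a, 'd) config"
    and g :: "('a, 'd) config \<Rightarrow> complex"
    and \<alpha> :: real
    and \<xi> :: "('a, 'd) config set"
  assumes "cellular_automaton F"
    and "surj F"
    and "\<xi> = {x. equicontinuity_point F x}"
    and "measure uniform_bernoulli \<xi> > 0"
    and "measurable_eigenfunction uniform_bernoulli F (exp (2 * of_real pi * \<i> * of_real \<alpha>)) g"
    and "\<forall>x\<in>\<xi>. g x \<noteq> 0"
  shows "\<alpha> \<in> \<rat>"
proof (rule ccontr)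
  assume irrational: "\<alpha> \<notin> \<rat>"
  from assms(1) obtain K f where "finite K" "\<And>x m. F x m = f (restrict (\<lambda>k. x (m + k)) K)"
    unfolding cellular_automaton_def by blast
  then interpret surjective_local_map F K f
    using assms(2) by unfold_locales
  define w where "w = exp (2 * of_real pi * \<i> * of_real \<alpha> :: complex)"
  have g: "g \<in> borel_measurable uniform_bernoulli"
    and eigen: "AE x in uniform_bernoulli. g (F x) = w * g x"
    using assms(5) by (auto simp: measurable_eigenfunction_def w_def)
  have eigen_power: "AE x in uniform_bernoulli. g ((F ^^ n) x) = w ^ n * g x" for n
  proof (induction n)
    case (Suc n)
    have "AE x in uniform_bernoulli. g ((F ^^ n) (F x)) = w ^ n * g (F x)"
      using Suc.IH by (intro AE_distrD[OF measurable_local_map]) (simp only: distr_uniform_bernoulli)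
    with eigen show ?case
      by eventually_elim (simp add: funpow_swap1)
  qed simp
  \<comment> \<open>A set of positive measure is measurable, since \<^const>\<open>measure\<close> is 0 off the sigma-algebra.\<close>
  have \<xi>: "\<xi> \<in> sets uniform_bernoulli"
    using assms(4) measure_notin_sets by fastforce
  define R where "R = {x. 0 \<le> Re (g x)}"
  define I where "I = {x. 0 \<le> Im (g x)}"
  have "{x \<in> space uniform_bernoulli. 0 \<le> Re (g x)} \<in> sets uniform_bernoulli"
    "{x \<in> space uniform_bernoulli. 0 \<le> Im (g x)} \<in> sets uniform_bernoulli"
    using g by measurable
  then have sets: "R \<in> sets uniform_bernoulli" "I \<in> sets uniform_bernoulli"
    by (simp_all add: R_def I_def)
  have per: "nearly_periodic_on \<xi> B" if "B \<in> sets uniform_bernoulli" for B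
    using assms(3) that by (intro nearly_periodic_on_measurable \<xi>) auto
  obtain P where P: "P > 0"
    "\<And>j. measure uniform_bernoulli (deviation \<xi> R (j * P)) < measure uniform_bernoulli \<xi> / 2"
    "\<And>j. measure uniform_bernoulli (deviation \<xi> I (j * P)) < measure uniform_bernoulli \<xi> / 2"
    using nearly_periodic_on_common_period[OF per[OF sets(1)] per[OF sets(2)],
        of "measure uniform_bernoulli \<xi> / 2"] assms(4) by auto
  have "w ^ P \<noteq> 1" using exp_power_eq_1_rational P(1) irrational by (auto simp: w_def)
  moreover have "norm (w ^ P) = 1" by (simp add: w_def norm_power norm_exp)
  ultimately obtain j where j: "Re ((w ^ P) ^ j) < 0" using unit_power_in_left_half_plane by metis
  define n where "n = j * P"
  have neg: "Re (w ^ n) < 0" using j by (simp add: n_def power_mult[symmetric] mult.commute)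
  have "AE x in uniform_bernoulli. x \<in> \<xi> \<longrightarrow> x \<in> deviation \<xi> R n \<union> deviation \<xi> I n"
    using eigen_power[of n]
  proof eventually_elim
    case (elim x)
    show ?case
    proof
      assume x: "x \<in> \<xi>"
      then have "g x \<noteq> 0" using assms(6) by blast
      from quadrant_changes[OF neg this] x show "x \<in> deviation \<xi> R n \<union> deviation \<xi> I n"
        by (simp add: deviation_def R_def I_def elim)
    qed
  qed
  then have "measure uniform_bernoulli \<xi>
      \<le> measure uniform_bernoulli (deviation \<xi> R n \<union> deviation \<xi> I n)"
    using \<xi> sets by (intro bernoulli.finite_measure_mono_AE sets.Un deviation_sets)
  also have "\<dots> \<le> measure uniform_bernoulli (deviation \<xi> R n)
      + measure uniform_bernoulli (deviation \<xi> I n)"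
    using \<xi> sets by (intro measure_Un_le deviation_sets)
  also have "\<dots> < measure uniform_bernoulli \<xi>"
    using P(2,3)[of j] unfolding n_def by simp
  finally show False by simp
qed

end
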